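(* Let $U$ be an infinite set and let $\mathcal F\subseteq 2^U$ be a family of subsets of $U$ of Vapnik–Chervonenkis dimension $d$. Then for every integer $n>0$ there is a set $X\subset U$ with $|X|=n$ such that every subfamily of $\mathcal F$ that separates $X$ has at least $\frac{n-1}{d}$ members.
   Context: The VC-dimension of $\mathcal F$ is the largest $d$ for which there is a $d$-element set $A$ such that for every $B\subseteq A$ some $F\in\mathcal F$ has $F\cap A=B$. A family separates $X$ if for any two distinct $x,y\in X$ some member of the family contains exactly one of $x,y$. *)

theory Defs
  imports Complex_Main
begin

definition shatters :: "'a set set \<Rightarrow> 'a set \<Rightarrow> bool" where
  "shatters \<F> A \<longleftrightarrow> (\<forall>B\<subseteq>A. \<exists>F\<in>\<F>. F \<inter> A = B)"

(* A relation rather than a function, since no largest d exists when \<F> is empty or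
   has unbounded dimension. The ground set need not be mentioned: taking B = A shows
   that a shattered set lies inside some member of \<F>. *)
definition has_VC_dim :: "'a set set \<Rightarrow> nat \<Rightarrow> bool" where
  "has_VC_dim \<F> d \<longleftrightarrow>
     (\<exists>A. finite A \<and> card A = d \<and> shatters \<F> A) \<and>
     (\<forall>e. (\<exists>A. finite A \<and> card A = e \<and> shatters \<F> A) \<longrightarrow> e \<le> d)"

definition separates :: "'a set set \<Rightarrow> 'a set \<Rightarrow> bool" where
  "separates \<G> X \<longleftrightarrow> (\<forall>x\<in>X. \<forall>y\<in>X. x \<noteq> y \<longrightarrow> (\<exists>F\<in>\<G>. (x \<in> F) \<noteq> (y \<in> F)))"

(* Bounds of the form r / d \<le> |\<G>| for a dimension d are to be written as
   r \<le> d * |\<G>|, restricted to finite \<G>: for d > 0 this is the same, while for d = 0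
   HOL's r / 0 = 0 would make the quotient bound vacuous. The product form then says
   that r \<le> 0, that is, r / 0 counts as infinity for r > 0. An infinite \<G> (whose card
   is 0) has at least r / d members in any case. *)

end

theory Submission
  imports Defs "HOL-Library.Ramsey"
begin

text \<open>
  Colour every $(d+1)$-subset of an infinite sequence in \<open>U\<close> by a $0$-$1$ word of length $d+1$ that
  no member of the family induces on it. Ramsey's theorem yields an infinite subsequence on which
  one word \<open>w\<close> is never induced, so the membership word of every member avoids \<open>w\<close> as a subsequence.
  Matching \<open>w\<close> greedily shows that such a word is determined by at most $d$ positions: single
  exceptional points (where two consecutive letters of \<open>w\<close> agree) and points where the default
  value flips (where they differ). With $m$ members separating $n$ points, the points that are
  exceptional for no member must all be separated by flips, so $n - 1 \<le> d m$.
\<close>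

text \<open>Induction on \<open>w\<close>, with \<open>a\<close> general so that the matching can
  restart after a matched position. Let \<open>p\<close> be the first position carrying the first
  letter. Up to \<open>p\<close> the values are the opposite letter, and beyond \<open>p\<close> the
  tail of \<open>w\<close> is avoided. Each matched letter costs one position in \<open>E\<close> or
  \<open>B\<close>; the last letter is never matched, hence the strict bound. Keeping
  \<open>B\<close> in \<open>{a..}\<close> makes the flip count start at zero.\<close>

lemma word_avoiding_determined_by_cuts:
  fixes P :: "nat \<Rightarrow> bool"
  assumes "w \<noteq> []"
    and "\<And>ps. sorted_wrt (<) ps \<Longrightarrow> set ps \<subseteq> {a..<n} \<Longrightarrow> map P ps \<noteq> w"
  shows "\<exists>E B. finite E \<and> finite B \<and> card E + card B < length w \<and> B \<subseteq> {a..} \<and>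
    (\<forall>x\<in>{a..<n} - E. P x = (hd w = odd (card {b\<in>B. b \<le> x})))"
  using assms
proof (induction w arbitrary: a)
  case Nil
  then show ?case by simp
next
  case (Cons c w)
  show ?case
  proof (cases "\<exists>p\<in>{a..<n}. P p = c")
    case False
    then show ?thesis by (intro exI[of _ "{}"]) auto
  next
    case True
    then have "\<exists>p. p \<in> {a..<n} \<and> P p = c" by blast
    then obtain p where p: "p \<in> {a..<n}" "P p = c"
      and least: "\<And>x. x < p \<Longrightarrow> \<not> (x \<in> {a..<n} \<and> P x = c)"
      using exists_least_iff[of "\<lambda>p. p \<in> {a..<n} \<and> P p = c"] by blast
    have before: "P x \<noteq> c" if "a \<le> x" "x < p" for x
      using least[of x] that p(1) by auto
    \<comment> \<open>If the tail were empty, \<open>[p]\<close> alone would spell the whole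
      word.\<close>
    have "w \<noteq> []"
      using Cons.prems(2)[of "[p]"] p by auto
    moreover have "map P ps \<noteq> w" if "sorted_wrt (<) ps" "set ps \<subseteq> {Suc p..<n}" for ps
      using Cons.prems(2)[of "p # ps"] that p by fastforce
    ultimately obtain E B where fin: "finite E" "finite B"
      and less: "card E + card B < length w" and B: "B \<subseteq> {Suc p..}"
      and det: "\<And>x. x \<in> {Suc p..<n} - E \<Longrightarrow> P x = (hd w = odd (card {b\<in>B. b \<le> x}))"
      using Cons.IH[of "Suc p"] by blast
    have no_cut: "even (card {b\<in>B. b \<le> x})" if "x \<le> p" for x
    proof -
      have "{b\<in>B. b \<le> x} = {}" using B that by auto
      then show ?thesis by (simp only: card.empty even_zero)
    qed
    show ?thesis
    proof (cases "hd w = c")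
      case True
      \<comment> \<open>The next letter is again \<open>c\<close>, so the default value is the same
        on both sides of \<open>p\<close> and only \<open>p\<close> itself deviates.\<close>
      have "card (insert p E) + card B < length (c # w)"
        using less card_insert_le_m1[of "Suc (card E)" E p] by simp
      moreover have "P x = (c = odd (card {b\<in>B. b \<le> x}))"
        if "x \<in> {a..<n} - insert p E" for x
      proof (cases "x < p")
        case True
        then show ?thesis using before[of x] no_cut[of x] that by auto
      next
        case False
        then show ?thesis using det[of x] that \<open>hd w = c\<close> by auto
      qed
      ultimately show ?thesis
        using fin B p by (intro exI[of _ "insert p E"] exI[of _ B]) auto
    next
      case False
      \<comment> \<open>The next letter is the negation of \<open>c\<close>. A cut at
        \<open>p\<close> changes the parity from \<open>p\<close> on, which compensates for
        replacing \<open>hd w\<close> by \<open>c\<close>.\<close>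
      have flips: "card {b\<in>insert p B. b \<le> x} = Suc (card {b\<in>B. b \<le> x})" if "p \<le> x" for x
      proof -
        have "{b\<in>insert p B. b \<le> x} = insert p {b\<in>B. b \<le> x}"
          using that by auto
        moreover have "p \<notin> B" using B by auto
        ultimately show ?thesis using fin by simp
      qed
      have "card E + card (insert p B) < length (c # w)"
        using less card_insert_le_m1[of "Suc (card B)" B p] by simp
      moreover have "P x = (c = odd (card {b\<in>insert p B. b \<le> x}))"
        if "x \<in> {a..<n} - E" for x
      proof -
        consider "x < p" | "x = p" | "p < x" by linarith
        then show ?thesis
        proof cases
          case 1
          then have "{b\<in>insert p B. b \<le> x} = {}" using B by auto
          then have "even (card {b\<in>insert p B. b \<le> x})" by (simp only: card.empty even_zero)
          then show ?thesis using before[of x] that 1 by auto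
        next
          case 2
          then show ?thesis using flips[of x] no_cut[of x] p(2) by simp
        next
          case 3
          then show ?thesis using flips[of x] det[of x] that False by auto
        qed
      qed
      ultimately show ?thesis
        using fin B p by (intro exI[of _ E] exI[of _ "insert p B"]) auto
    qed
  qed
qed

lemma not_shatters_imp_missing_word:
  fixes f :: "nat \<Rightarrow> 'a"
  assumes "\<not> shatters \<F> (f ` A)" "finite A"
  shows "\<exists>w. length w = card A \<and> (\<forall>F\<in>\<F>. map (\<lambda>i. f i \<in> F) (sorted_list_of_set A) \<noteq> w)"
proof -
  obtain B where B: "B \<subseteq> f ` A" "\<And>F. F \<in> \<F> \<Longrightarrow> F \<inter> f ` A \<noteq> B"
    using assms(1) unfolding shatters_def by blast
  have "map (\<lambda>i. f i \<in> F) (sorted_list_of_set A) \<noteq> map (\<lambda>i. f i \<in> B) (sorted_list_of_set A)"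
    if "F \<in> \<F>" for F
  proof
    assume "map (\<lambda>i. f i \<in> F) (sorted_list_of_set A) = map (\<lambda>i. f i \<in> B) (sorted_list_of_set A)"
    then have "\<forall>i\<in>A. f i \<in> F \<longleftrightarrow> f i \<in> B"
      using assms(2) by simp
    then have "F \<inter> f ` A = B" using B(1) by blast
    then show False using B(2) that by blast
  qed
  then show ?thesis
    by (intro exI[of _ "map (\<lambda>i. f i \<in> B) (sorted_list_of_set A)"]) simp
qed

lemma exists_sequence_avoiding_word:
  fixes U :: "'a set"
  assumes "infinite U"
    and not_shattered: "\<And>A. finite A \<Longrightarrow> card A = k \<Longrightarrow> \<not> shatters \<F> A"
  obtains g :: "nat \<Rightarrow> 'a" and w
  where "inj g" "range g \<subseteq> U" "length w = k"
    "\<And>F ps. F \<in> \<F> \<Longrightarrow> sorted_wrt (<) ps \<Longrightarrow> map (\<lambda>i. g i \<in> F) ps \<noteq> w"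
proof -
  obtain f :: "nat \<Rightarrow> 'a" where f: "inj f" "range f \<subseteq> U"
    using infinite_countable_subset[OF assms(1)] by blast
  define missing where "missing A w \<longleftrightarrow> length w = k \<and>
    (\<forall>F\<in>\<F>. map (\<lambda>i. f i \<in> F) (sorted_list_of_set A) \<noteq> w)" for A w
  define colour where "colour A = (SOME w. missing A w)" for A
  have colour: "missing A (colour A)" if "finite A" "card A = k" for A
  proof -
    have "card (f ` A) = k"
      using that f(1) by (simp add: card_image inj_on_subset)
    then have "\<exists>w. missing A w"
      using not_shatters_imp_missing_word[of \<F> f A] not_shattered[of "f ` A"] that
      unfolding missing_def by auto
    then show ?thesis unfolding colour_def by (rule someI_ex)
  qed
  \<comment> \<open>\<open>Ramsey\<close> expects colours that are naturals below a bound, so the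
    finitely many words are numbered by \<open>h\<close>.\<close>
  define W where "W = {w :: bool list. length w = k}"
  have "finite W"
    unfolding W_def using finite_lists_length_eq[of "UNIV :: bool set" k] by simp
  then obtain h :: "bool list \<Rightarrow> nat" where h: "bij_betw h W {0..<card W}"
    using ex_bij_betw_finite_nat by blast
  have "\<forall>A. A \<subseteq> (UNIV :: nat set) \<and> finite A \<and> card A = k \<longrightarrow> h (colour A) < card W"
    using colour h unfolding missing_def W_def bij_betw_def by fastforce
  then obtain Y t where Y: "infinite Y"
    and t: "\<And>A. A \<subseteq> Y \<Longrightarrow> finite A \<Longrightarrow> card A = k \<Longrightarrow> h (colour A) = t"
    using Ramsey[of "UNIV :: nat set" k "\<lambda>A. h (colour A)" "card W"] by auto
  \<comment> \<open>Ramsey's theorem yields only the number \<open>t\<close>. One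
    \<open>k\<close>-subset of \<open>Y\<close> names the word behind it, and injectivity of
    \<open>h\<close> on \<open>W\<close> carries that word to all others.\<close>
  obtain A where A: "A \<subseteq> Y" "finite A" "card A = k"
    using infinite_arbitrarily_large[OF Y] by blast
  define w where "w = colour A"
  have w: "colour C = w" if C: "C \<subseteq> Y" "finite C" "card C = k" for C
  proof -
    have "colour A \<in> W" "colour C \<in> W"
      using colour[of A] colour[of C] A C unfolding missing_def W_def by auto
    moreover have "h (colour C) = h (colour A)"
      using t[of A] t[of C] A C by simp
    ultimately show ?thesis
      using h unfolding w_def bij_betw_def inj_on_def by blast
  qed
  have len: "length w = k"
    using colour[of A] A unfolding w_def missing_def by simp
  define e where "e = enumerate Y"
  have e: "strict_mono e" "\<And>i. e i \<in> Y"
    unfolding e_def using Y by (auto simp: strict_mono_enumerate enumerate_in_set)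
  have "map (\<lambda>i. (f \<circ> e) i \<in> F) ps \<noteq> w" if F: "F \<in> \<F>" and ps: "sorted_wrt (<) ps" for F ps
  proof
    assume eq: "map (\<lambda>i. (f \<circ> e) i \<in> F) ps = w"
    define qs where "qs = map e ps"
    have qs: "sorted_wrt (<) qs"
      unfolding qs_def sorted_wrt_map
      using ps sorted_wrt_mono_rel[of ps "(<)" "\<lambda>x y. e x < e y"] e(1)
      by (simp add: strict_mono_less)
    then have sorted: "sorted qs" "distinct qs"
      by (auto simp: strict_sorted_iff)
    \<comment> \<open>An occurrence of \<open>w\<close> has exactly \<open>k\<close> positions, so
      they form a coloured set; being increasing, \<open>qs\<close> is the list along which the
      missing word of that set is read.\<close>
    have "length qs = k"
      using eq len unfolding qs_def by (metis length_map)
    then have "card (set qs) = k"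
      using sorted by (simp add: distinct_card)
    moreover have "set qs \<subseteq> Y"
      using e(2) unfolding qs_def by auto
    ultimately have "missing (set qs) w"
      using colour[of "set qs"] w[of "set qs"] by simp
    moreover have "sorted_list_of_set (set qs) = qs"
      using sorted by (simp add: sorted_list_of_set.idem_if_sorted_distinct)
    moreover have "map (\<lambda>i. f i \<in> F) qs = w"
      using eq unfolding qs_def by (simp add: comp_def)
    ultimately show False
      using F unfolding missing_def by auto
  qed
  moreover have "inj (f \<circ> e)"
    using f(1) e(1) by (simp add: inj_compose strict_mono_imp_inj_on)
  moreover have "range (f \<circ> e) \<subseteq> U"
    using f(2) by auto
  ultimately show ?thesis
    using that[of "f \<circ> e" w] len by simp
qed

text \<open>Pool the exceptions and cuts of all members. Two points outside \<open>EE\<close> with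
  no pooled cut between them lie in the same members, so separation makes the number of pooled cuts
  up to a point injective there.\<close>

lemma separating_cuts_bound:
  fixes \<G> :: "'b set" and Q :: "'b \<Rightarrow> nat \<Rightarrow> bool"
  assumes "finite \<G>"
    and sep: "\<And>x y. x < n \<Longrightarrow> y < n \<Longrightarrow> x \<noteq> y \<Longrightarrow> \<exists>F\<in>\<G>. Q F x \<noteq> Q F y"
    and cuts: "\<And>F. F \<in> \<G> \<Longrightarrow> \<exists>E B. finite E \<and> finite B \<and> card E + card B \<le> d \<and>
      (\<forall>x\<in>{..<n} - E. Q F x = (c = odd (card {b\<in>B. b \<le> x})))"
  shows "n \<le> d * card \<G> + 1"
proof -
  define determines where "determines F E B \<longleftrightarrow> finite E \<and> finite B \<and> card E + card B \<le> d \<and>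
    (\<forall>x\<in>{..<n} - E. Q F x = (c = odd (card {b\<in>B. b \<le> x})))" for F E B
  have "\<forall>F\<in>\<G>. \<exists>E B. determines F E B"
    using cuts unfolding determines_def by blast
  then obtain E B where "\<And>F. F \<in> \<G> \<Longrightarrow> determines F (E F) (B F)"
    by metis
  then have fin: "\<And>F. F \<in> \<G> \<Longrightarrow> finite (E F)" "\<And>F. F \<in> \<G> \<Longrightarrow> finite (B F)"
    and le: "\<And>F. F \<in> \<G> \<Longrightarrow> card (E F) + card (B F) \<le> d"
    and det: "\<And>F x. F \<in> \<G> \<Longrightarrow> x \<in> {..<n} - E F \<Longrightarrow>
      Q F x = (c = odd (card {b\<in>B F. b \<le> x}))"
    unfolding determines_def by blast+
  define EE where "EE = (\<Union>F\<in>\<G>. E F)"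
  define BB where "BB = (\<Union>F\<in>\<G>. B F)"
  have finEE: "finite EE" and finBB: "finite BB"
    using assms(1) fin unfolding EE_def BB_def by auto
  have "card EE + card BB \<le> (\<Sum>F\<in>\<G>. card (E F)) + (\<Sum>F\<in>\<G>. card (B F))"
    unfolding EE_def BB_def by (intro add_mono card_UN_le assms(1))
  also have "\<dots> = (\<Sum>F\<in>\<G>. card (E F) + card (B F))"
    by (simp add: sum.distrib)
  also have "\<dots> \<le> d * card \<G>"
    using sum_bounded_above[of \<G> "\<lambda>F. card (E F) + card (B F)" d] le by (simp add: mult.commute)
  finally have total: "card EE + card BB \<le> d * card \<G>" .
  have "inj_on (\<lambda>x. card {b\<in>BB. b \<le> x}) ({..<n} - EE)"
  proof (rule linorder_inj_onI', rule notI)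
    fix x y
    assume xy: "x \<in> {..<n} - EE" "y \<in> {..<n} - EE" "x < y"
      and eq: "card {b\<in>BB. b \<le> x} = card {b\<in>BB. b \<le> y}"
    have "x < n" "y < n" "x \<noteq> y"
      using xy by auto
    then obtain F where F: "F \<in> \<G>" "Q F x \<noteq> Q F y"
      using sep by blast
    \<comment> \<open>The sets are nested because \<open>x < y\<close>, so equal cardinality forces
      equality.\<close>
    have "{b\<in>BB. b \<le> x} = {b\<in>BB. b \<le> y}"
      using eq finBB xy(3) by (intro card_subset_eq) auto
    then have "{b\<in>B F. b \<le> x} = {b\<in>B F. b \<le> y}"
      using F(1) unfolding BB_def by blast
    moreover have "x \<in> {..<n} - E F" "y \<in> {..<n} - E F"
      using xy F(1) unfolding EE_def by auto
    ultimately show False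
      using det[OF F(1)] F(2) by simp
  qed
  moreover have "(\<lambda>x. card {b\<in>BB. b \<le> x}) ` ({..<n} - EE) \<subseteq> {..card BB}"
    using finBB by (auto intro: card_mono)
  ultimately have "card ({..<n} - EE) \<le> card {..card BB}"
    by (rule card_inj_on_le) simp
  \<comment> \<open>The count ranges from 0 to \<open>card BB\<close>; this is the source of the 1
    in \<open>n - 1\<close>.\<close>
  then have "card ({..<n} - EE) \<le> card BB + 1"
    by simp
  moreover have "n - card EE \<le> card ({..<n} - EE)"
    using diff_card_le_card_Diff[OF finEE, of "{..<n}"] by simp
  ultimately show ?thesis
    using total by linarith
qed

theorem theorem5:
  fixes U :: "'a set" and \<F> :: "'a set set" and d :: nat
  assumes "infinite U"
    and "\<F> \<subseteq> Pow U"
    and "has_VC_dim \<F> d"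
  shows "\<forall>n::nat. n > 0 \<longrightarrow>
    (\<exists>X\<subseteq>U. finite X \<and> card X = n \<and>
      (\<forall>\<G>\<subseteq>\<F>. separates \<G> X \<longrightarrow> finite \<G> \<longrightarrow>
        real n - 1 \<le> real d * real (card \<G>)))"
proof (intro allI impI)
  fix n :: nat
  assume "n > 0"
  \<comment> \<open>The missing word gets length \<open>Suc d\<close>, the least size beyond the
    VC-dimension; \<open>X\<close> will be the first \<open>n\<close> terms of the sequence avoiding
    it.\<close>
  have "\<not> shatters \<F> A" if "finite A" "card A = Suc d" for A
    using assms(3) that unfolding has_VC_dim_def by (metis Suc_n_not_le_n)
  from exists_sequence_avoiding_word[OF assms(1) this]
  obtain g :: "nat \<Rightarrow> 'a" and w where g: "inj g" "range g \<subseteq> U" and len: "length w = Suc d"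
    and avoid: "\<And>F ps. F \<in> \<F> \<Longrightarrow> sorted_wrt (<) ps \<Longrightarrow> map (\<lambda>i. g i \<in> F) ps \<noteq> w"
    by metis
  have "real n - 1 \<le> real d * real (card \<G>)"
    if \<G>: "\<G> \<subseteq> \<F>" "separates \<G> (g ` {..<n})" "finite \<G>" for \<G>
  proof -
    have "n \<le> d * card \<G> + 1"
    proof (rule separating_cuts_bound[of \<G> n "\<lambda>F i. g i \<in> F" d "hd w"])
      fix x y
      assume "x < n" "y < n" "x \<noteq> y"
      then show "\<exists>F\<in>\<G>. (g x \<in> F) \<noteq> (g y \<in> F)"
        using \<G>(2) g(1) unfolding separates_def by (simp add: inj_eq)
    next
      fix F
      assume "F \<in> \<G>"
      then have "F \<in> \<F>"
        using \<G>(1) by auto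
      moreover have "w \<noteq> []"
        using len by force
      \<comment> \<open>With \<open>length w = Suc d\<close> the strict bound leaves at most
        \<open>d\<close> positions per member.\<close>
      ultimately have "\<exists>E B. finite E \<and> finite B \<and> card E + card B < length w \<and> B \<subseteq> {0..} \<and>
          (\<forall>x\<in>{0..<n} - E. (g x \<in> F) = (hd w = odd (card {b\<in>B. b \<le> x})))"
        by (intro word_avoiding_determined_by_cuts avoid)
      then show "\<exists>E B. finite E \<and> finite B \<and> card E + card B \<le> d \<and>
          (\<forall>x\<in>{..<n} - E. (g x \<in> F) = (hd w = odd (card {b\<in>B. b \<le> x})))"
        unfolding len less_Suc_eq_le atLeast0LessThan by (elim exE conjE) (intro exI conjI)
    qed (fact \<G>(3))
    then have "real n \<le> real (d * card \<G> + 1)"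
      by (simp only: of_nat_le_iff)
    then show ?thesis
      by simp
  qed
  moreover have "card (g ` {..<n}) = n"
    using g(1) by (simp add: card_image inj_on_subset)
  moreover have "g ` {..<n} \<subseteq> U"
    using g(2) by auto
  ultimately show "\<exists>X\<subseteq>U. finite X \<and> card X = n \<and>
      (\<forall>\<G>\<subseteq>\<F>. separates \<G> X \<longrightarrow> finite \<G> \<longrightarrow>
        real n - 1 \<le> real d * real (card \<G>))"
    by (intro exI[of _ "g ` {..<n}"]) auto
qed

end
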